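(* Let $n,k\ge1$, let $a_1,\dots,a_{kn}\ge 0$ be real numbers and let $b_1\le b_2\le\cdots\le b_{kn}$ be the numbers $a_i$ reordered in nondecreasing order. Then $$n\sqrt[n]{\prod_{i=1}^{kn}a_i}\le\sum_{j=1}^n\prod_{i=1}^k a_{(j-1)k+i}\le\sum_{j=1}^n\prod_{i=1}^k b_{(j-1)k+i}$$ and $$\prod_{j=1}^n\sum_{i=1}^k b_{(j-1)k+i}\le\prod_{j=1}^n\sum_{i=1}^k a_{(j-1)k+i}\le\left(\frac{\sum_{i=1}^{kn}a_i}{n}\right)^n.$$ Moreover, if $c_1,\dots,c_{kn}$ is a reordering of the numbers $a_i$ such that $\prod_{i=1}^k c_{(j-1)k+i}=\prod_{i=1}^k c_{(l-1)k+i}$ for all $1\le j,l\le n$, then $$\sum_{j=1}^n\prod_{i=1}^k c_{(j-1)k+i}\le\sum_{j=1}^n\prod_{i=1}^k a_{(j-1)k+i};$$ and if $c_1,\dots,c_{kn}$ is a reordering of the numbers $a_i$ such that $\sum_{i=1}^k c_{(j-1)k+i}=\sum_{i=1}^k c_{(l-1)k+i}$ for all $1\le j,l\le n$, then $$\prod_{j=1}^n\sum_{i=1}^k a_{(j-1)k+i}\le\prod_{j=1}^n\sum_{i=1}^k c_{(j-1)k+i}.$$ *)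

theory Defs
  imports Complex_Main "HOL-Combinatorics.Permutations"
begin

(* Sequences x_1, ..., x_N are functions on nat of which only the values at 1, ..., N matter. *)
definition is_reordering :: "nat \<Rightarrow> (nat \<Rightarrow> real) \<Rightarrow> (nat \<Rightarrow> real) \<Rightarrow> bool" where
  "is_reordering N x y \<longleftrightarrow> (\<exists>p. p permutes {1..N} \<and> (\<forall>i\<in>{1..N}. y i = x (p i)))"

end

theory Submission
  imports Defs "HOL-Analysis.Convex"
begin

text \<open>
  The two rearrangement inequalities are proved by exchange. Regard an arrangement as an assignment
  of the indices of the sorted sequence to blocks of size \<open>k\<close>, and take a block whose value (product,
  respectively sum of its entries) is largest. Swapping one of its entries for an entry of another
  block that is at least as large never decreases the sum of the block products, never increases
  the product of the block sums, and leaves the chosen block a largest one. So that block can be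
  turned into the top \<open>k\<close> indices, and one proceeds by induction on the number of blocks. The
  remaining inequalities are AM-GM, which is an equality when all blocks have the same value.
\<close>

section \<open>AM-GM in power form and in root form\<close>

text \<open>This form bounds the product of the block sums from above; the root form below bounds
  the sum of the block products from below.\<close>

lemma am_gm_power:
  fixes x :: "'a \<Rightarrow> real"
  assumes "finite S" "S \<noteq> {}" "\<And>i. i \<in> S \<Longrightarrow> 0 \<le> x i"
  shows "(\<Prod>i\<in>S. x i) \<le> ((\<Sum>i\<in>S. x i) / card S) ^ card S"
proof -
  have pos: "card S > 0"
    using assms by (simp add: card_gt_0_iff)
  have nn: "(\<Prod>i\<in>S. x i) \<ge> 0"
    using assms by (simp add: prod_nonneg)
  have "(\<Prod>i\<in>S. x i) powr (1 / card S) \<le> (\<Sum>i\<in>S. x i) / card S"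
    using arith_geom_mean[of S x] assms by (simp add: sum_divide_distrib)
  then have "root (card S) (\<Prod>i\<in>S. x i) \<le> (\<Sum>i\<in>S. x i) / card S"
    using pos nn by (cases "prod x S = 0") (simp_all add: root_powr_inverse)
  then have "root (card S) (\<Prod>i\<in>S. x i) ^ card S \<le> ((\<Sum>i\<in>S. x i) / card S) ^ card S"
    by (intro power_mono) (use nn pos in auto)
  then show ?thesis
    using pos nn by simp
qed

lemma am_gm_root:
  fixes x :: "'a \<Rightarrow> real"
  assumes "finite S" "S \<noteq> {}" "\<And>i. i \<in> S \<Longrightarrow> 0 \<le> x i"
  shows "card S * root (card S) (\<Prod>i\<in>S. x i) \<le> (\<Sum>i\<in>S. x i)"
proof -
  have pos: "card S > 0"
    using assms by (simp add: card_gt_0_iff)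
  have "root (card S) (\<Prod>i\<in>S. x i) \<le> root (card S) (((\<Sum>i\<in>S. x i) / card S) ^ card S)"
    using am_gm_power[OF assms] pos by simp
  also have "\<dots> = (\<Sum>i\<in>S. x i) / card S"
    using pos by (intro real_root_power_cancel) (auto intro!: divide_nonneg_nonneg sum_nonneg assms)
  finally show ?thesis
    using pos by (simp add: field_simps)
qed

section \<open>The exchange argument for both inequalities at once\<close>

text \<open>Here \<open>w\<close> is the value of a block and \<open>f\<close> combines these
  values; \<open>R\<close> is \<le> for sums of products and \<ge> for products of sums, so an
  exchange always moves forward along \<open>R\<close>. The last premise of
  \<open>w_exchange\<close> says that the block receiving the larger entry already has the larger
  value.\<close>

locale block_exchange = comm_monoid_set f e
  for f :: "real \<Rightarrow> real \<Rightarrow> real" and e :: real +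
  fixes R :: "real \<Rightarrow> real \<Rightarrow> bool" and b :: "nat \<Rightarrow> real" and w :: "nat set \<Rightarrow> real"
  assumes R_refl: "R u u"
    and R_trans: "R u v \<Longrightarrow> R v y \<Longrightarrow> R u y"
    and R_mono: "R u v \<Longrightarrow> 0 \<le> y \<Longrightarrow> R (f y u) (f y v)"
    and f_nonneg: "0 \<le> u \<Longrightarrow> 0 \<le> v \<Longrightarrow> 0 \<le> f u v"
    and e_nonneg: "0 \<le> e"
    and w_nonneg: "0 \<le> w A"
    and w_mono: "finite A \<Longrightarrow> x \<notin> A \<Longrightarrow> t \<notin> A \<Longrightarrow> b x \<le> b t \<Longrightarrow> w (insert x A) \<le> w (insert t A)"
    and w_exchange: "finite A \<Longrightarrow> finite B \<Longrightarrow> x \<notin> A \<Longrightarrow> t \<notin> A \<Longrightarrow> x \<notin> B \<Longrightarrow> t \<notin> B \<Longrightarrow>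
      b x \<le> b t \<Longrightarrow> w (insert t B) \<le> w (insert x A) \<Longrightarrow>
      R (f (w (insert x A)) (w (insert t B))) (f (w (insert t A)) (w (insert x B)))"
begin

lemma F_nonneg: "0 \<le> F (\<lambda>j. w (S j)) J"
  by (induction J rule: infinite_finite_induct) (auto simp: e_nonneg w_nonneg f_nonneg)

text \<open>Induction on the number of elements of \<open>T\<close> missing from block
  \<open>j\<close>: each step swaps one of them in. That block \<open>j\<close> stays a largest one
  is the invariant which allows the next exchange.\<close>

lemma fill_largest_block:
  fixes g :: "nat \<Rightarrow> nat"
  assumes "finite U" "finite J" "j \<in> J" "T \<subseteq> U" "card T = k"
    and "\<And>t x. t \<in> T \<Longrightarrow> x \<in> U - T \<Longrightarrow> b x \<le> b t"
    and "g ` U \<subseteq> J" "\<And>l. l \<in> J \<Longrightarrow> card (U \<inter> g -` {l}) = k"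
    and "\<And>l. l \<in> J \<Longrightarrow> w (U \<inter> g -` {l}) \<le> w (U \<inter> g -` {j})"
  shows "\<exists>g'. g' ` U \<subseteq> J \<and> (\<forall>l\<in>J. card (U \<inter> g' -` {l}) = k) \<and> U \<inter> g' -` {j} = T \<and>
    R (F (\<lambda>l. w (U \<inter> g -` {l})) J) (F (\<lambda>l. w (U \<inter> g' -` {l})) J)"
  using assms(7-)
proof (induction "card (T - g -` {j})" arbitrary: g rule: less_induct)
  case less
  let ?S = "\<lambda>g l. U \<inter> g -` {l}"
  have finT: "finite T" using assms finite_subset by blast
  show ?case
  proof (cases "T \<subseteq> ?S g j")
    case True
    then have "T = ?S g j"
      using assms less.prems(2)[of j] by (intro card_subset_eq) auto
    then show ?thesis using less.prems R_refl by blast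
  next
    case False
    then obtain t where t: "t \<in> T" "g t \<noteq> j" using assms by auto
    \<comment> \<open>Block \<open>j\<close> and \<open>T\<close> both have \<open>k\<close>
      elements, so if \<open>T\<close> is not exhausted then block \<open>j\<close> contains some
      \<open>x\<close> outside \<open>T\<close> to give away.\<close>
    have "\<not> ?S g j \<subseteq> T"
    proof
      assume "?S g j \<subseteq> T"
      then have "?S g j = T"
        using finT assms less.prems(2)[of j] by (intro card_subset_eq) auto
      with False show False by auto
    qed
    then obtain x where x: "x \<in> U" "g x = j" "x \<notin> T" by auto
    have tU: "t \<in> U" using t assms by auto
    define l where "l = g t"
    have l: "l \<in> J" "l \<noteq> j" using t tU less.prems(1) by (auto simp: l_def)
    have bxt: "b x \<le> b t" using assms(6) t x by auto
    define h where "h = g \<circ> transpose x t"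
    define A where "A = ?S g j - {x}"
    define B where "B = ?S g l - {t}"
    have fin: "finite A" "finite B" using assms by (auto simp: A_def B_def)
    have notin: "x \<notin> A" "t \<notin> A" "x \<notin> B" "t \<notin> B"
      using t x l by (auto simp: A_def B_def)
    have gj: "?S g j = insert x A" and gl: "?S g l = insert t B"
      using t x l tU by (auto simp: A_def B_def l_def)
    have hj: "?S h j = insert t A" and hl: "?S h l = insert x B"
      using t x l tU by (auto simp: A_def B_def l_def h_def transpose_def split: if_splits)
    have ho: "?S h m = ?S g m" if "m \<noteq> j" "m \<noteq> l" for m
      using t x l tU that by (auto simp: l_def h_def transpose_def split: if_splits)
    \<comment> \<open>By \<open>w_mono\<close> the swap does not lower block \<open>j\<close> and
      does not raise block \<open>l\<close>; all other blocks are unchanged.\<close>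
    have mx: "w (?S h m) \<le> w (?S h j)" if "m \<in> J" for m
    proof -
      have up: "w (?S g j) \<le> w (?S h j)"
        unfolding gj hj using fin notin bxt by (intro w_mono)
      have "w (?S h l) \<le> w (?S g l)"
        unfolding gl hl using fin notin bxt by (intro w_mono)
      then have "w (?S h m) \<le> w (?S g m) \<or> m = j"
        using ho by (cases "m = j"; cases "m = l") auto
      then show ?thesis using up less.prems(3)[OF that] by auto
    qed
    have him: "h ` U \<subseteq> J"
      using less.prems(1) x tU by (auto simp: h_def transpose_def)
    have hcard: "card (?S h m) = k" if "m \<in> J" for m
      using less.prems(2)[of m] less.prems(2)[of j] less.prems(2)[of l] that l assms(3) fin notin
      by (cases "m = j"; cases "m = l") (auto simp: hj hl gj gl ho)
    have "T - h -` {j} \<subset> T - g -` {j}"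
      using t x l by (auto simp: h_def transpose_def split: if_splits)
    then have dec: "card (T - h -` {j}) < card (T - g -` {j})"
      using finT by (intro psubset_card_mono) auto
    have step: "R (F (\<lambda>m. w (?S g m)) J) (F (\<lambda>m. w (?S h m)) J)"
    proof -
      \<comment> \<open>The blocks in \<open>?K\<close> are untouched and contribute the same
        nonnegative value before and after, so \<open>R_mono\<close> extends the two-block exchange
        to all of \<open>J\<close>.\<close>
      let ?K = "J - {j} - {l}"
      have split: "F \<phi> J = f (F \<phi> ?K) (f (\<phi> j) (\<phi> l))" for \<phi>
        using remove[of J j \<phi>] remove[of "J - {j}" l \<phi>] assms l by (simp add: ac_simps)
      have "F (\<lambda>m. w (?S h m)) ?K = F (\<lambda>m. w (?S g m)) ?K"
        by (rule cong) (auto simp: ho)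
      moreover have "R (f (w (?S g j)) (w (?S g l))) (f (w (?S h j)) (w (?S h l)))"
        unfolding gj gl hj hl
        using fin notin bxt less.prems(3)[OF l(1)] by (intro w_exchange) (auto simp: gj gl)
      ultimately show ?thesis
        unfolding split[of "\<lambda>m. w (?S g m)"] split[of "\<lambda>m. w (?S h m)"]
        by (simp add: R_mono F_nonneg)
    qed
    show ?thesis
      using less.hyps[OF dec him hcard mx] step R_trans by blast
  qed
qed

text \<open>Induction on \<open>n\<close>: a largest block is turned into the top \<open>k\<close>
  indices, and the other \<open>n\<close> blocks then partition the lower \<open>k * n\<close>
  indices. The label set \<open>J\<close> is arbitrary because any label may be the one
  removed.\<close>

lemma sorted_blocks_extremal:
  fixes g :: "nat \<Rightarrow> nat"
  assumes "mono_on {1..k * n} b" "finite J" "card J = n"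
    and "g ` {1..k * n} \<subseteq> J" "\<And>l. l \<in> J \<Longrightarrow> card ({1..k * n} \<inter> g -` {l}) = k"
  shows "R (F (\<lambda>l. w ({1..k * n} \<inter> g -` {l})) J) (F (\<lambda>j. w {(j - 1) * k + 1..j * k}) {1..n})"
  using assms
proof (induction n arbitrary: J g)
  case 0
  then show ?case by (simp add: R_refl)
next
  case (Suc n)
  let ?U = "{1..k * Suc n}" and ?U' = "{1..k * n}"
  let ?T = "{k * n + 1..k * Suc n}"
  have "J \<noteq> {}" using Suc.prems by auto
  then obtain j where j: "j \<in> J" and
    jmax: "\<And>l. l \<in> J \<Longrightarrow> w (?U \<inter> g -` {l}) \<le> w (?U \<inter> g -` {j})"
    using obtains_MAX[of J "\<lambda>l. w (?U \<inter> g -` {l})"] Max_ge[of "(\<lambda>l. w (?U \<inter> g -` {l})) ` J"] Suc.prems(2)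
    by (metis finite_imageI imageI)
  have "\<exists>g'. g' ` ?U \<subseteq> J \<and> (\<forall>l\<in>J. card (?U \<inter> g' -` {l}) = k) \<and> ?U \<inter> g' -` {j} = ?T \<and>
    R (F (\<lambda>l. w (?U \<inter> g -` {l})) J) (F (\<lambda>l. w (?U \<inter> g' -` {l})) J)"
  proof (rule fill_largest_block)
    show "b x \<le> b t" if "t \<in> ?T" "x \<in> ?U - ?T" for t x
      by (rule mono_onD[OF Suc.prems(1)]) (use that in auto)
  qed (use Suc.prems j jmax in auto)
  then obtain h where h: "h ` ?U \<subseteq> J" "\<And>l. l \<in> J \<Longrightarrow> card (?U \<inter> h -` {l}) = k"
    "?U \<inter> h -` {j} = ?T"
    "R (F (\<lambda>l. w (?U \<inter> g -` {l})) J) (F (\<lambda>l. w (?U \<inter> h -` {l})) J)"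
    by blast
  \<comment> \<open>Block \<open>j\<close> uses up all top indices, so cutting down to
    \<open>?U'\<close> does not change the other blocks.\<close>
  have fibre: "?U \<inter> h -` {l} = ?U' \<inter> h -` {l}" if "l \<noteq> j" for l
  proof -
    have "i \<notin> ?T" if "i \<in> ?U" "h i = l" for i
      using h(3) \<open>l \<noteq> j\<close> that by blast
    then show ?thesis by force
  qed
  have notj: "h i \<noteq> j" if "i \<in> ?U'" for i
  proof
    assume "h i = j"
    with that have "i \<in> ?U \<inter> h -` {j}" by auto
    then show False unfolding h(3) using that by auto
  qed
  have "R (F (\<lambda>l. w (?U' \<inter> h -` {l})) (J - {j})) (F (\<lambda>j. w {(j - 1) * k + 1..j * k}) {1..n})"
  proof (rule Suc.IH)
    show "mono_on ?U' b"
      using Suc.prems(1) by (rule mono_on_subset) auto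
    show "h ` ?U' \<subseteq> J - {j}"
      using h(1) notj by fastforce
    show "card (?U' \<inter> h -` {l}) = k" if "l \<in> J - {j}" for l
      using h(2)[of l] fibre[of l] that by simp
  qed (use Suc.prems j in auto)
  moreover have "F (\<lambda>l. w (?U' \<inter> h -` {l})) (J - {j}) = F (\<lambda>l. w (?U \<inter> h -` {l})) (J - {j})"
    by (intro cong refl) (metis DiffD2 fibre singletonI)
  ultimately have "R (f (w ?T) (F (\<lambda>l. w (?U \<inter> h -` {l})) (J - {j})))
      (f (w ?T) (F (\<lambda>j. w {(j - 1) * k + 1..j * k}) {1..n}))"
    by (simp add: R_mono w_nonneg)
  also have "f (w ?T) (F (\<lambda>l. w (?U \<inter> h -` {l})) (J - {j})) = F (\<lambda>l. w (?U \<inter> h -` {l})) J"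
    using remove[of J j "\<lambda>l. w (?U \<inter> h -` {l})"] Suc.prems(2) j h(3) by simp
  also have "f (w ?T) (F (\<lambda>j. w {(j - 1) * k + 1..j * k}) {1..n})
      = F (\<lambda>j. w {(j - 1) * k + 1..j * k}) {1..Suc n}"
    by (simp add: atLeastAtMostSuc_conv algebra_simps)
  finally show ?case using h(4) R_trans by blast
qed

end

section \<open>The two instances of the exchange argument\<close>

text \<open>The gain of an exchange is \<open>(b t - b x) * (prod b A - prod b B)\<close>, so it
  suffices that \<open>prod b B\<close> is at most \<open>prod b A\<close>.\<close>

lemma block_exchange_sum_prod:
  fixes b :: "nat \<Rightarrow> real"
  assumes "\<And>i. 0 \<le> b i"
  shows "block_exchange (+) 0 (\<le>) b (prod b)"
proof unfold_locales
  fix A B :: "nat set" and x t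
  assume *: "finite A" "finite B" "x \<notin> A" "t \<notin> A" "x \<notin> B" "t \<notin> B" "b x \<le> b t"
    "prod b (insert t B) \<le> prod b (insert x A)"
  have nn: "0 \<le> prod b A" "0 \<le> prod b B" "0 \<le> b x" "0 \<le> b t"
    using assms by (auto intro: prod_nonneg)
  have le: "b t * prod b B \<le> b x * prod b A" using * by simp
  have "b x * prod b A + b t * prod b B \<le> b t * prod b A + b x * prod b B"
  \<comment> \<open>Comparing the two products requires cancelling \<open>b t\<close>; if it
    vanishes, so does \<open>b x\<close>, and both sides are 0.\<close>
  proof (cases "b t = 0")
    case True
    then show ?thesis using nn *(7) by simp
  next
    case False
    have "b t * prod b B \<le> b t * prod b A"
      using le mult_right_mono[OF *(7) nn(1)] by linarith
    then have "prod b B \<le> prod b A" using False nn by simp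
    then have "0 \<le> (b t - b x) * (prod b A - prod b B)" using *(7) by simp
    then show ?thesis by (simp add: algebra_simps)
  qed
  then show "prod b (insert x A) + prod b (insert t B) \<le> prod b (insert t A) + prod b (insert x B)"
    using * by simp
qed (use assms in \<open>auto intro!: prod_nonneg mult_right_mono\<close>)

text \<open>An exchange lowers the product by \<open>(b t - b x) * (sum b A - sum b B)\<close>, and
  here both factors are nonnegative directly from the premises.\<close>

lemma block_exchange_prod_sum:
  fixes b :: "nat \<Rightarrow> real"
  assumes "\<And>i. 0 \<le> b i"
  shows "block_exchange (*) 1 (\<ge>) b (sum b)"
proof unfold_locales
  fix A B :: "nat set" and x t
  assume *: "finite A" "finite B" "x \<notin> A" "t \<notin> A" "x \<notin> B" "t \<notin> B" "b x \<le> b t"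
    "sum b (insert t B) \<le> sum b (insert x A)"
  have "0 \<le> (b t - b x) * (sum b A - sum b B)" using * by simp
  then have "(b t + sum b A) * (b x + sum b B) \<le> (b x + sum b A) * (b t + sum b B)"
    by (simp add: algebra_simps)
  then show "sum b (insert t A) * sum b (insert x B) \<le> sum b (insert x A) * sum b (insert t B)"
    using * by simp
qed (use assms in \<open>auto intro!: sum_nonneg mult_left_mono\<close>)

section \<open>Consecutive blocks and their reindexing\<close>

text \<open>Indices and block numbers start at 1, hence the shift to 0 before the division and back
  afterwards.\<close>

lemma block_number_iff:
  fixes i j k :: nat
  assumes "1 \<le> k" "1 \<le> i" "1 \<le> j"
  shows "(i - 1) div k + 1 = j \<longleftrightarrow> i \<in> {(j - 1) * k + 1..j * k}"
proof -
  obtain i' j' where ij: "i = Suc i'" "j = Suc j'"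
    using assms by (metis Suc_le_D One_nat_def)
  have "i' div k = j' \<longleftrightarrow> j' * k \<le> i' \<and> i' < Suc j' * k"
    using assms dividend_less_div_times[of k i'] by (auto simp: div_nat_eqI mult.commute)
  then show ?thesis by (auto simp: ij)
qed

lemma block_subset:
  fixes j k n :: nat
  assumes "j \<in> {1..n}"
  shows "{(j - 1) * k + 1..j * k} \<subseteq> {1..k * n}"
  using assms mult_le_mono1[of j n k] by (auto simp: mult.commute)

lemma (in comm_monoid_set) block_reindex:
  fixes j k :: nat
  assumes "1 \<le> j"
  shows "F (\<lambda>i. x ((j - 1) * k + i)) {1..k} = F x {(j - 1) * k + 1..j * k}"
proof (rule reindex_bij_witness[where i = "\<lambda>m. m - (j - 1) * k" and j = "\<lambda>i. (j - 1) * k + i"])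
qed (use assms in \<open>auto simp: algebra_simps le_diff_conv\<close>, (cases j; auto)+)

text \<open>Lets AM-GM, applied to the \<open>n\<close> block values, speak about the product or sum
  of all entries.\<close>

lemma (in comm_monoid_set) blocks:
  fixes k n :: nat
  shows "F (\<lambda>j. F (\<lambda>i. x ((j - 1) * k + i)) {1..k}) {1..n} = F x {1..k * n}"
proof -
  have "F (\<lambda>j. F (\<lambda>i. x ((j - 1) * k + i)) {1..k}) {1..n}
      = F (\<lambda>j. F x {(j - 1) * k + 1..j * k}) {1..n}"
    by (intro cong refl block_reindex[of _ x k]) auto
  also have "\<dots> = F x {1..k * n}"
  proof (induction n)
    case (Suc n)
    have "{1..k * Suc n} = {1..k * n} \<union> {n * k + 1..Suc n * k}"
      by (auto simp: algebra_simps)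
    then have "F x {1..k * Suc n} = f (F x {1..k * n}) (F x {n * k + 1..Suc n * k})"
      by (simp only:) (rule union_disjoint, auto simp: algebra_simps)
    with Suc show ?case by (simp add: atLeastAtMostSuc_conv ac_simps)
  qed simp
  finally show ?thesis .
qed

lemma (in comm_monoid_set) reordering:
  assumes "p permutes {1..N}" "\<forall>i\<in>{1..N}. y i = x (p i)"
  shows "F y {1..N::nat} = F x {1..N}"
  using permute[OF assms(1), of x] cong[OF refl, of "{1..N}" y "x \<circ> p"] assms(2) by simp

text \<open>
  If \<open>y i = x (p i)\<close>, then \<open>(p i - 1) div k + 1\<close> is the number of the block of \<open>x\<close> which contains the
  \<open>i\<close>-th entry of \<open>y\<close>.
\<close>
lemma bij_betw_fibre_block:
  fixes p :: "nat \<Rightarrow> nat"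
  assumes "1 \<le> k" "p permutes {1..k * n}" "j \<in> {1..n}"
  shows "bij_betw p ({1..k * n} \<inter> (\<lambda>i. (p i - 1) div k + 1) -` {j}) {(j - 1) * k + 1..j * k}"
proof (rule bij_betw_imageI)
  let ?U = "{1..k * n}"
  show "inj_on p (?U \<inter> (\<lambda>i. (p i - 1) div k + 1) -` {j})"
    using permutes_inj[OF assms(2)] by (rule inj_on_subset) auto
  have num: "(p i - 1) div k + 1 = j \<longleftrightarrow> p i \<in> {(j - 1) * k + 1..j * k}" if "i \<in> ?U" for i
    using block_number_iff[of k "p i" j] permutes_in_image[OF assms(2), of i] assms that by auto
  have "m \<in> p ` ?U" if "m \<in> {(j - 1) * k + 1..j * k}" for m
    using block_subset[OF assms(3)] that permutes_image[OF assms(2)] by blast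
  then show "p ` (?U \<inter> (\<lambda>i. (p i - 1) div k + 1) -` {j}) = {(j - 1) * k + 1..j * k}"
    using num by fastforce
qed

text \<open>Translates a block of the given sequence \<open>x\<close> into a set of indices of the
  reordered sequence \<open>y\<close>, the setting in which the exchange argument works.\<close>

lemma (in comm_monoid_set) block_as_fibre:
  fixes p :: "nat \<Rightarrow> nat"
  assumes "1 \<le> k" "p permutes {1..k * n}" "\<forall>i\<in>{1..k * n}. y i = x (p i)" "j \<in> {1..n}"
  shows "F (\<lambda>i. x ((j - 1) * k + i)) {1..k}
    = F y ({1..k * n} \<inter> (\<lambda>i. (p i - 1) div k + 1) -` {j})"
proof -
  have "F (\<lambda>i. x ((j - 1) * k + i)) {1..k} = F x {(j - 1) * k + 1..j * k}"
    using assms(4) by (intro block_reindex) auto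
  also have "\<dots> = F (\<lambda>i. x (p i)) ({1..k * n} \<inter> (\<lambda>i. (p i - 1) div k + 1) -` {j})"
    using reindex_bij_betw[OF bij_betw_fibre_block[OF assms(1,2,4)], of x] by simp
  also have "\<dots> = F y ({1..k * n} \<inter> (\<lambda>i. (p i - 1) div k + 1) -` {j})"
    by (intro cong refl) (use assms(3) in auto)
  finally show ?thesis .
qed

lemma (in block_exchange) sorted_blocks_extremal_permuted:
  fixes p :: "nat \<Rightarrow> nat"
  assumes "1 \<le> k" "p permutes {1..k * n}" "mono_on {1..k * n} b"
  shows "R (F (\<lambda>l. w ({1..k * n} \<inter> (\<lambda>i. (p i - 1) div k + 1) -` {l})) {1..n})
    (F (\<lambda>j. w {(j - 1) * k + 1..j * k}) {1..n})"
proof (rule sorted_blocks_extremal[OF assms(3)])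
  show "card ({1..k * n} \<inter> (\<lambda>i. (p i - 1) div k + 1) -` {l}) = k" if "l \<in> {1..n}" for l
    using bij_betw_same_card[OF bij_betw_fibre_block[OF assms(1,2) that]] that by (cases l) auto
  show "(\<lambda>i. (p i - 1) div k + 1) ` {1..k * n} \<subseteq> {1..n}"
  proof clarify
    fix i assume "i \<in> {1..k * n}"
    then have "p i \<in> {1..k * n}" using permutes_in_image[OF assms(2)] by blast
    then have "p i - 1 < n * k" by (auto simp: mult.commute)
    then have "(p i - 1) div k < n" by (rule less_mult_imp_div_less)
    then show "(p i - 1) div k + 1 \<in> {1..n}" by auto
  qed
qed auto

section \<open>Assembly of the six inequalities\<close>

theorem corollary6:
  fixes n k :: nat and a b :: "nat \<Rightarrow> real"
  assumes "n \<ge> 1" and "k \<ge> 1"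
    and "\<forall>i\<in>{1..k * n}. a i \<ge> 0"
    and "is_reordering (k * n) a b"
    and "mono_on {1..k * n} b"
  shows "real n * root n (\<Prod>i=1..k * n. a i) \<le> (\<Sum>j=1..n. \<Prod>i=1..k. a ((j - 1) * k + i))
    \<and> (\<Sum>j=1..n. \<Prod>i=1..k. a ((j - 1) * k + i)) \<le> (\<Sum>j=1..n. \<Prod>i=1..k. b ((j - 1) * k + i))
    \<and> (\<Prod>j=1..n. \<Sum>i=1..k. b ((j - 1) * k + i)) \<le> (\<Prod>j=1..n. \<Sum>i=1..k. a ((j - 1) * k + i))
    \<and> (\<Prod>j=1..n. \<Sum>i=1..k. a ((j - 1) * k + i)) \<le> ((\<Sum>i=1..k * n. a i) / real n) ^ n
    \<and> (\<forall>c. is_reordering (k * n) a c \<longrightarrow>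
          (\<forall>j\<in>{1..n}. \<forall>l\<in>{1..n}.
             (\<Prod>i=1..k. c ((j - 1) * k + i)) = (\<Prod>i=1..k. c ((l - 1) * k + i))) \<longrightarrow>
          (\<Sum>j=1..n. \<Prod>i=1..k. c ((j - 1) * k + i)) \<le> (\<Sum>j=1..n. \<Prod>i=1..k. a ((j - 1) * k + i)))
    \<and> (\<forall>c. is_reordering (k * n) a c \<longrightarrow>
          (\<forall>j\<in>{1..n}. \<forall>l\<in>{1..n}.
             (\<Sum>i=1..k. c ((j - 1) * k + i)) = (\<Sum>i=1..k. c ((l - 1) * k + i))) \<longrightarrow>
          (\<Prod>j=1..n. \<Sum>i=1..k. a ((j - 1) * k + i)) \<le> (\<Prod>j=1..n. \<Sum>i=1..k. c ((j - 1) * k + i)))"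
proof -
  let ?U = "{1..k * n}"
  obtain p where p: "p permutes ?U" "\<forall>i\<in>?U. b i = a (p i)"
    using assms(4) unfolding is_reordering_def by blast
  \<comment> \<open>The instances need nonnegative entries at every index, while \<open>b\<close> is
    only controlled on \<open>?U\<close>; the default value 0 repairs this.\<close>
  define b' where "b' i = (if i \<in> ?U then b i else 0)" for i
  have pU: "p i \<in> ?U" if "i \<in> ?U" for i
    using permutes_in_image[OF p(1)] that by blast
  have b'_nonneg: "0 \<le> b' i" for i
    using assms(3) p(2) pU by (auto simp: b'_def)
  have mono: "mono_on ?U b'"
    using assms(5) by (auto simp: mono_on_def b'_def)
  have b': "\<forall>i\<in>?U. b' i = a (p i)"
    using p(2) by (simp add: b'_def)
  have b'_block: "b' i = b i" if "i \<in> {(j - 1) * k + 1..j * k}" "j \<in> {1..n}" for i j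
    using subsetD[OF block_subset[OF that(2), of k] that(1)] by (simp add: b'_def)

  interpret sp: block_exchange "(+)" 0 "(\<le>)" b' "prod b'"
    rewrites "comm_monoid_set.F (+) (0::real) = sum"
    by (rule block_exchange_sum_prod[OF b'_nonneg]) (simp add: sum_def)
  interpret ps: block_exchange "(*)" 1 "(\<ge>)" b' "sum b'"
    rewrites "comm_monoid_set.F (*) (1::real) = prod"
    by (rule block_exchange_prod_sum[OF b'_nonneg]) (simp add: prod_def)

  let ?P = "\<lambda>x j. \<Prod>i=1..k. x ((j - 1) * k + i)" and ?S = "\<lambda>x j. \<Sum>i=1..k. x ((j - 1) * k + i)"
  have Pb: "?P b j = prod b' {(j - 1) * k + 1..j * k}"
    and Sb: "?S b j = sum b' {(j - 1) * k + 1..j * k}" if "j \<in> {1..n}" for j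
    using that prod.block_reindex[of j b k] sum.block_reindex[of j b k]
      prod.cong[OF refl, of _ b' b] sum.cong[OF refl, of _ b' b] b'_block[OF _ that]
    by auto
  \<comment> \<open>The blocks of \<open>a\<close> are fibres of the block-number map over the
    sorted indices, while those of \<open>b\<close> are the consecutive index blocks.\<close>
  have "(\<Sum>j=1..n. ?P a j) \<le> (\<Sum>j=1..n. ?P b j)"
    using sp.sorted_blocks_extremal_permuted[OF assms(2) p(1) mono]
    by (simp only: prod.block_as_fibre[OF assms(2) p(1) b'] Pb cong: sum.cong)
  moreover have "(\<Prod>j=1..n. ?S b j) \<le> (\<Prod>j=1..n. ?S a j)"
    using ps.sorted_blocks_extremal_permuted[OF assms(2) p(1) mono]
    by (simp only: sum.block_as_fibre[OF assms(2) p(1) b'] Sb cong: prod.cong)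
  moreover have a_nonneg: "0 \<le> a ((j - 1) * k + i)" if "j \<in> {1..n}" "i \<in> {1..k}" for i j
  proof -
    have "(j - 1) * k + i \<in> {(j - 1) * k + 1..j * k}"
      using that by (cases j) auto
    then show ?thesis using block_subset[OF that(1)] assms(3) by blast
  qed
  have P_nonneg: "0 \<le> ?P a j" and S_nonneg: "0 \<le> ?S a j" if "j \<in> {1..n}" for j
    using a_nonneg[OF that] by (auto intro: prod_nonneg sum_nonneg)
  have P: "real n * root n (\<Prod>i\<in>?U. a i) \<le> (\<Sum>j=1..n. ?P a j)"
    using am_gm_root[of "{1..n}" "?P a"] P_nonneg assms(1) prod.blocks[of a k n] by simp
  moreover have S: "(\<Prod>j=1..n. ?S a j) \<le> ((\<Sum>i\<in>?U. a i) / real n) ^ n"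
    using am_gm_power[of "{1..n}" "?S a"] S_nonneg assms(1) sum.blocks[of a k n] by simp
  moreover have "(\<Sum>j=1..n. ?P c j) \<le> (\<Sum>j=1..n. ?P a j)"
    if c: "is_reordering (k * n) a c" and eq: "\<forall>j\<in>{1..n}. \<forall>l\<in>{1..n}. ?P c j = ?P c l" for c
  proof -
    obtain q where q: "q permutes ?U" "\<forall>i\<in>?U. c i = a (q i)"
      using c unfolding is_reordering_def by blast
    have const: "?P c j = ?P c 1" if "j \<in> {1..n}" for j
      using bspec[OF bspec[OF eq that], of 1] assms(1) by simp
    have "0 \<le> c i" if "i \<in> {1..k}" for i
    proof -
      have "i \<in> ?U" using that assms(1) by (auto intro: order_trans[of _ k])
      then show ?thesis using q permutes_in_image[OF q(1), of i] assms(3) by simp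
    qed
    then have nn: "0 \<le> ?P c 1" by (auto intro!: prod_nonneg)
    \<comment> \<open>Equal block products make \<open>c\<close> attain the AM-GM lower bound, which
      depends only on the product of all entries and so is shared with \<open>a\<close>.\<close>
    have "(\<Prod>i\<in>?U. a i) = ?P c 1 ^ n"
      using prod.reordering[OF q] prod.blocks[of c k n] prod.cong[of "{1..n}" "{1..n}" "?P c", OF refl const] by simp
    then have "real n * root n (\<Prod>i\<in>?U. a i) = real n * ?P c 1"
      using nn assms(1) by (simp add: real_root_power_cancel)
    also have "\<dots> = (\<Sum>j=1..n. ?P c j)"
      using sum.cong[of "{1..n}" "{1..n}" "?P c", OF refl const] by simp
    finally show ?thesis using P by simp
  qed
  moreover have "(\<Prod>j=1..n. ?S a j) \<le> (\<Prod>j=1..n. ?S c j)"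
    if c: "is_reordering (k * n) a c" and eq: "\<forall>j\<in>{1..n}. \<forall>l\<in>{1..n}. ?S c j = ?S c l" for c
  proof -
    obtain q where q: "q permutes ?U" "\<forall>i\<in>?U. c i = a (q i)"
      using c unfolding is_reordering_def by blast
    have const: "?S c j = ?S c 1" if "j \<in> {1..n}" for j
      using bspec[OF bspec[OF eq that], of 1] assms(1) by simp
    \<comment> \<open>Likewise, equal block sums make \<open>c\<close> attain the upper bound, which
      depends only on the total sum.\<close>
    have "(\<Sum>i\<in>?U. a i) = real n * ?S c 1"
      using sum.reordering[OF q] sum.blocks[of c k n] sum.cong[of "{1..n}" "{1..n}" "?S c", OF refl const] by simp
    then have "((\<Sum>i\<in>?U. a i) / real n) ^ n = ?S c 1 ^ n"
      using assms(1) by simp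
    also have "\<dots> = (\<Prod>j=1..n. ?S c j)"
      using prod.cong[of "{1..n}" "{1..n}" "?S c", OF refl const] by simp
    finally show ?thesis using S by simp
  qed
  ultimately show ?thesis by blast
qed

end
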